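(* Let $X,Y$ be Banach spaces, let $A:D(A)\subset X\to X$ generate a $C_0$-semigroup $T(\cdot)$ on $X$, and let $C\in\mathcal L(X,Y)$. For the system $\dot x(t)=Ax(t)$, $y(t)=Cx(t)$, the following statements are equivalent: (i) the system is OSS; (ii) the system is OSS with linear gain; (iii) the system is eOSS; (iv) the system is eOSS with linear gain.
   Context: $\mathcal L(X,Y)$ denotes the bounded linear operators from $X$ to $Y$. $\mathbb R_+=[0,\infty)$. The mild solution of the system with initial state $x\in X$ is $\phi(t,x)=T(t)x$, and the output trajectory is $y(t,x)=CT(t)x$, $t\ge 0$. Comparison functions: $\mathcal K$ is the set of continuous strictly increasing $\gamma:\mathbb R_+\to\mathbb R_+$ with $\gamma(0)=0$. $\mathcal L$ is the set of continuous strictly decreasing functions $\mathbb R_+\to\mathbb R_+$ tending to $0$ at infinity. $\mathcal{KL}$ is the set of continuous $\beta:\mathbb R_+\times\mathbb R_+\to\mathbb R_+$ such that $\beta(\cdot,t)\in\mathcal K$ for all $t\ge0$ and $\beta(r,\cdot)\in\mathcal L$ for all $r>0$. The system is OSS (output-to-state stable) if there exist $\beta\in\mathcal{KL}$ and $\gamma\in\mathcal K$ such that for all $x\in X$ and $t\ge0$: $\|\phi(t,x)\|_X\le\beta(\|x\|_X,t)+\gamma\bigl(\max_{s\in[0,t]}\|y(s,x)\|_Y\bigr)$. It is OSS with linear gain if in addition $\gamma$ can be chosen linear. The system is eOSS (exponentially output-to-state stable) if there exist $M,\mu>0$ and $\gamma\in\mathcal K$ such that for all $x\in X$ and $t\ge0$: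 $\|\phi(t,x)\|_X\le Me^{-\mu t}\|x\|_X+\gamma\bigl(\max_{s\in[0,t]}\|y(s,x)\|_Y\bigr)$. It is eOSS with linear gain if in addition $\gamma$ can be chosen linear. *)

theory Defs
  imports "HOL-Analysis.Analysis"
begin

text \<open>
  Class \<open>banach\<close> is over the reals. A complex Banach space is in particular a real one, and
  complex-linear operators are real-linear, so the complex case is included.
\<close>

definition C0_semigroup :: "(real \<Rightarrow> 'a::banach \<Rightarrow>\<^sub>L 'a) \<Rightarrow> bool" where
  "C0_semigroup T \<longleftrightarrow>
     T 0 = id_blinfun \<and>
     (\<forall>s\<ge>0. \<forall>t\<ge>0. T (s + t) = T s o\<^sub>L T t) \<and>
     (\<forall>x. ((\<lambda>t. blinfun_apply (T t) x) \<longlongrightarrow> x) (at_right 0))"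

text \<open>
  An unbounded operator is given by its domain \<open>D\<close> and a total function \<open>A\<close>, of which only the
  values on \<open>D\<close> matter.
\<close>

definition generates_C0_semigroup ::
    "'a::banach set \<Rightarrow> ('a \<Rightarrow> 'a) \<Rightarrow> (real \<Rightarrow> 'a \<Rightarrow>\<^sub>L 'a) \<Rightarrow> bool" where
  "generates_C0_semigroup D A T \<longleftrightarrow>
     C0_semigroup T \<and>
     D = {x. \<exists>z. ((\<lambda>h. (blinfun_apply (T h) x - x) /\<^sub>R h) \<longlongrightarrow> z) (at_right 0)} \<and>
     (\<forall>x\<in>D. ((\<lambda>h. (blinfun_apply (T h) x - x) /\<^sub>R h) \<longlongrightarrow> A x) (at_right 0))"

definition class_K :: "(real \<Rightarrow> real) set" where
  "class_K = {\<gamma>. \<gamma> ` {0..} \<subseteq> {0..} \<and> continuous_on {0..} \<gamma> \<and> strict_mono_on {0..} \<gamma> \<and> \<gamma> 0 = 0}"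

definition class_L :: "(real \<Rightarrow> real) set" where
  "class_L = {\<gamma>. \<gamma> ` {0..} \<subseteq> {0..} \<and> continuous_on {0..} \<gamma> \<and>
     strict_antimono_on {0..} \<gamma> \<and> (\<gamma> \<longlongrightarrow> 0) at_top}"

definition class_KL :: "(real \<Rightarrow> real \<Rightarrow> real) set" where
  "class_KL = {\<beta>. continuous_on ({0..} \<times> {0..}) (\<lambda>(r, t). \<beta> r t) \<and>
     (\<forall>t\<ge>0. (\<lambda>r. \<beta> r t) \<in> class_K) \<and> (\<forall>r>0. \<beta> r \<in> class_L)}"

definition linear_gain :: "(real \<Rightarrow> real) \<Rightarrow> bool" where
  "linear_gain \<gamma> \<longleftrightarrow> (\<exists>c. \<forall>r\<ge>0. \<gamma> r = c * r)"

definition mild_solution :: "(real \<Rightarrow> 'a::banach \<Rightarrow>\<^sub>L 'a) \<Rightarrow> real \<Rightarrow> 'a \<Rightarrow> 'a" where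
  "mild_solution T t x = blinfun_apply (T t) x"

definition output_trajectory ::
    "(real \<Rightarrow> 'a::banach \<Rightarrow>\<^sub>L 'a) \<Rightarrow> ('a \<Rightarrow>\<^sub>L 'b::banach) \<Rightarrow> real \<Rightarrow> 'a \<Rightarrow> 'b" where
  "output_trajectory T C t x = blinfun_apply C (mild_solution T t x)"

text \<open>
  For a \<open>C\<^sub>0\<close>-semigroup the output is continuous in time, so the supremum over the compact interval
  is attained, i.e. it is the maximum.
\<close>

definition max_output ::
    "(real \<Rightarrow> 'a::banach \<Rightarrow>\<^sub>L 'a) \<Rightarrow> ('a \<Rightarrow>\<^sub>L 'b::banach) \<Rightarrow> real \<Rightarrow> 'a \<Rightarrow> real" where
  "max_output T C t x = (SUP s\<in>{0..t}. norm (output_trajectory T C s x))"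

definition OSS_estimate ::
    "(real \<Rightarrow> 'a::banach \<Rightarrow>\<^sub>L 'a) \<Rightarrow> ('a \<Rightarrow>\<^sub>L 'b::banach) \<Rightarrow>
     (real \<Rightarrow> real \<Rightarrow> real) \<Rightarrow> (real \<Rightarrow> real) \<Rightarrow> bool" where
  "OSS_estimate T C \<beta> \<gamma> \<longleftrightarrow>
     (\<forall>x. \<forall>t\<ge>0. norm (mild_solution T t x) \<le> \<beta> (norm x) t + \<gamma> (max_output T C t x))"

definition OSS :: "(real \<Rightarrow> 'a::banach \<Rightarrow>\<^sub>L 'a) \<Rightarrow> ('a \<Rightarrow>\<^sub>L 'b::banach) \<Rightarrow> bool" where
  "OSS T C \<longleftrightarrow> (\<exists>\<beta>\<in>class_KL. \<exists>\<gamma>\<in>class_K. OSS_estimate T C \<beta> \<gamma>)"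

definition OSS_linear_gain :: "(real \<Rightarrow> 'a::banach \<Rightarrow>\<^sub>L 'a) \<Rightarrow> ('a \<Rightarrow>\<^sub>L 'b::banach) \<Rightarrow> bool" where
  "OSS_linear_gain T C \<longleftrightarrow>
     (\<exists>\<beta>\<in>class_KL. \<exists>\<gamma>\<in>class_K. linear_gain \<gamma> \<and> OSS_estimate T C \<beta> \<gamma>)"

definition eOSS_estimate ::
    "(real \<Rightarrow> 'a::banach \<Rightarrow>\<^sub>L 'a) \<Rightarrow> ('a \<Rightarrow>\<^sub>L 'b::banach) \<Rightarrow>
     real \<Rightarrow> real \<Rightarrow> (real \<Rightarrow> real) \<Rightarrow> bool" where
  "eOSS_estimate T C M \<mu> \<gamma> \<longleftrightarrow>
     (\<forall>x. \<forall>t\<ge>0. norm (mild_solution T t x) \<le>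
        M * exp (- \<mu> * t) * norm x + \<gamma> (max_output T C t x))"

definition eOSS :: "(real \<Rightarrow> 'a::banach \<Rightarrow>\<^sub>L 'a) \<Rightarrow> ('a \<Rightarrow>\<^sub>L 'b::banach) \<Rightarrow> bool" where
  "eOSS T C \<longleftrightarrow> (\<exists>M>0. \<exists>\<mu>>0. \<exists>\<gamma>\<in>class_K. eOSS_estimate T C M \<mu> \<gamma>)"

definition eOSS_linear_gain :: "(real \<Rightarrow> 'a::banach \<Rightarrow>\<^sub>L 'a) \<Rightarrow> ('a \<Rightarrow>\<^sub>L 'b::banach) \<Rightarrow> bool" where
  "eOSS_linear_gain T C \<longleftrightarrow>
     (\<exists>M>0. \<exists>\<mu>>0. \<exists>\<gamma>\<in>class_K. linear_gain \<gamma> \<and> eOSS_estimate T C M \<mu> \<gamma>)"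

end

theory Submission
  imports Defs
begin

text \<open>
  Exponential estimates are instances of \<open>class_KL\<close> estimates, so everything rests on passing from
  a general OSS estimate to an exponential one with linear gain. The system is linear, so the OSS
  estimate may be applied to \<open>\<lambda>x\<close> with the \<open>\<lambda>\<close> that makes \<open>\<parallel>\<lambda>x\<parallel> \<le> 1\<close> and the maximal output of
  \<open>\<lambda>x\<close> at most \<open>\<delta>\<close>. Undoing the scaling gives an estimate that is linear in both terms,
  \[ \<parallel>T(t)x\<parallel> \<le> (\<beta>(1,t) + \<gamma>(\<delta>)) (\<parallel>x\<parallel> + m_t(x) / \<delta>), \]
  where \<open>m_t(x)\<close> is the maximal output on \<open>[0,t]\<close> (lemma \<open>OSS_estimate_homogenized\<close>).

  Now take \<open>\<delta>\<close> small and then a time \<open>\<tau>\<close> large, so that the factor is at most \<open>1/2\<close> at time \<open>\<tau>\<close>.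
  On each interval of length \<open>\<tau>\<close> the norm of the state is halved, up to a multiple of the output.
  These output terms add up to a geometric series, which keeps the total gain linear
  (lemma \<open>halving_iterated\<close>), and halving at equidistant times is exponential decay.

  The output enters through a supremum, which is meaningful only if outputs are bounded on
  compact time intervals. The definition of a \<open>C\<^sub>0\<close>-semigroup grants continuity only at time zero
  and only pointwise, so that this bound comes from the uniform boundedness principle, which
  is derived from Baire's theorem.
\<close>

section \<open>Uniform boundedness\<close>

text \<open>
  The closed sets of those points at which all operators are bounded by \<open>n\<close> cover the space, so
  by Baire's theorem one of them contains a ball. On that ball, and hence by translation on a
  ball around zero, the operators are uniformly bounded.
\<close>

theorem uniform_boundedness_principle:
  fixes F :: "'i \<Rightarrow> 'a::banach \<Rightarrow>\<^sub>L 'b::real_normed_vector"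
  assumes ptw: "\<And>x. \<exists>B. \<forall>i\<in>I. norm (F i x) \<le> B"
  shows "\<exists>K. \<forall>i\<in>I. norm (F i) \<le> K"
proof -
  define V where "V n = {x. \<forall>i\<in>I. norm (F i x) \<le> real n}" for n
  have cl: "closed (V n)" for n
  proof -
    have "V n = (\<Inter>i\<in>I. {x. norm (F i x) \<le> real n})"
      by (auto simp: V_def)
    moreover have "closed {x. norm (F i x) \<le> real n}" for i
      by (intro closed_Collect_le continuous_intros)
    ultimately show ?thesis by auto
  qed
  have cover: "(\<Union>n. V n) = UNIV"
  proof (intro equalityI subsetI UNIV_I)
    fix x
    obtain B where "\<forall>i\<in>I. norm (F i x) \<le> B" using ptw by blast
    moreover obtain n where "B \<le> real n" using real_arch_simple by blast
    ultimately have "x \<in> V n" unfolding V_def by fastforce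
    then show "x \<in> (\<Union>n. V n)" by blast
  qed
  have "\<exists>n. interior (V n) \<noteq> {}"
  proof (rule ccontr)
    assume "\<not> ?thesis"
    then have "(euclidean :: 'a topology) interior_of (\<Union>(range V)) = {}"
      using cl completely_metrizable_space_euclidean
      by (intro Baire_category_alt) auto
    then show False using cover by simp
  qed
  then obtain n z where "z \<in> interior (V n)" by blast
  then obtain e where e: "e > 0" "ball z e \<subseteq> V n"
    using mem_interior by blast
  have small: "norm (F i x) \<le> 2 * real n" if "i \<in> I" "norm x < e" for i x
  proof -
    have "z \<in> V n" "z + x \<in> V n"
      using e that by (auto simp: subset_iff dist_norm)
    then have "norm (F i z) \<le> n" "norm (F i (z + x)) \<le> n"
      using that by (auto simp: V_def)
    moreover have "F i x = F i (z + x) - F i z"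
      by (simp add: blinfun.add_right)
    ultimately show ?thesis
      using norm_triangle_ineq4[of "F i (z + x)" "F i z"] by simp
  qed
  have "norm (F i) \<le> 4 * real n / e" if i: "i \<in> I" for i
  proof (rule norm_blinfun_bound)
    show "0 \<le> 4 * real n / e" using e by simp
    fix x
    show "norm (F i x) \<le> 4 * real n / e * norm x"
    proof (cases "x = 0")
      case False
      define c where "c = e / (2 * norm x)"
      have c: "c > 0" using False e by (simp add: c_def)
      have "norm (c *\<^sub>R x) < e" using False e by (simp add: c_def)
      then have "norm (F i (c *\<^sub>R x)) \<le> 2 * real n" by (rule small[OF i])
      then have "c * norm (F i x) \<le> 2 * real n"
        using c by (simp add: blinfun.scaleR_right)
      then show ?thesis using False e by (simp add: c_def field_simps)
    qed simp
  qed
  then show ?thesis by blast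
qed

section \<open>Operator semigroups on compact time intervals\<close>

lemma C0_semigroup_zero: "C0_semigroup T \<Longrightarrow> T 0 x = x"
  by (simp add: C0_semigroup_def)

lemma C0_semigroup_add:
  "C0_semigroup T \<Longrightarrow> 0 \<le> s \<Longrightarrow> 0 \<le> t \<Longrightarrow> T (s + t) x = T s (T t x)"
  by (simp add: C0_semigroup_def)

text \<open>
  Otherwise there are times \<open>s\<^sub>n\<close> tending to zero along which the operator norms are unbounded,
  although \<open>T(s\<^sub>n)x\<close> tends to \<open>x\<close> for every \<open>x\<close>.
\<close>

lemma C0_semigroup_bounded_near_zero:
  assumes T: "C0_semigroup T"
  shows "\<exists>d>0. \<exists>K. \<forall>s\<in>{0..d}. norm (T s) \<le> K"
proof (rule ccontr)
  assume neg: "\<not> ?thesis"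
  have "\<exists>s. s \<in> {0..1 / real (Suc n)} \<and> \<not> norm (T s) \<le> real n" for n
    using neg by (metis divide_pos_pos of_nat_0_less_iff zero_less_Suc zero_less_one)
  then obtain s where s: "\<And>n. s n \<in> {0..1 / real (Suc n)}" "\<And>n. norm (T (s n)) > real n"
    by (metis not_le)
  have "\<exists>B. \<forall>n\<in>UNIV. norm (T (s n) x) \<le> B" for x
  proof -
    have "((\<lambda>t. T t x) \<longlongrightarrow> x) (at_right 0)"
      using T by (simp add: C0_semigroup_def)
    then have "((\<lambda>t. norm (T t x)) \<longlongrightarrow> norm x) (at_right 0)"
      by (rule tendsto_norm)
    then have "\<forall>\<^sub>F t in at_right 0. norm (T t x) < norm x + 1"
      by (rule order_tendstoD) simp
    then obtain b where b: "b > 0" "\<And>t. 0 < t \<Longrightarrow> t < b \<Longrightarrow> norm (T t x) < norm x + 1"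
      unfolding eventually_at_right_field by auto
    have near: "norm (T t x) \<le> norm x + 1" if "0 \<le> t" "t < b" for t
      using b(2)[of t] that C0_semigroup_zero[OF T, of x] by (cases "t = 0") auto
    have "\<forall>\<^sub>F n in sequentially. 1 / real (Suc n) < b"
      using LIMSEQ_inverse_real_of_nat b(1)
      by (auto dest!: order_tendstoD(2)[where a = b] simp: inverse_eq_divide)
    then have "\<forall>\<^sub>F n in sequentially. norm (T (s n) x) \<le> norm x + 1"
    proof eventually_elim
      case (elim n)
      with s(1)[of n] show ?case by (intro near) auto
    qed
    then have "Bseq (\<lambda>n. T (s n) x)" by (rule BfunI)
    then show ?thesis unfolding Bseq_def by auto
  qed
  then obtain K where K: "\<And>n. norm (T (s n)) \<le> K"
    using uniform_boundedness_principle[of UNIV "\<lambda>n. T (s n)"] by auto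
  obtain n where "K \<le> real n" using real_arch_simple by blast
  with K[of n] s(2)[of n] show False by simp
qed

lemma C0_semigroup_bounded_on_compact:
  assumes T: "C0_semigroup T"
  shows "\<exists>K. \<forall>s\<in>{0..t}. norm (T s) \<le> K"
proof -
  obtain d K where d: "d > 0" and K: "\<And>s. s \<in> {0..d} \<Longrightarrow> norm (T s) \<le> K"
    using C0_semigroup_bounded_near_zero[OF T] by blast
  have "\<exists>L. \<forall>s\<in>{0..real n * d}. norm (T s) \<le> L" for n
  proof (induction n)
    case 0
    then show ?case by auto
  next
    case (Suc n)
    then obtain L where L: "\<And>s. s \<in> {0..real n * d} \<Longrightarrow> norm (T s) \<le> L" by blast
    have "norm (T s) \<le> max K (K * L)" if s: "s \<in> {0..real (Suc n) * d}" for s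
    proof (cases "s \<le> d")
      case True
      with s K[of s] show ?thesis by auto
    next
      case False
      have "T s = T d o\<^sub>L T (s - d)"
        using T d False unfolding C0_semigroup_def
        by (metis add.commute diff_add_cancel diff_ge_0_iff_ge less_imp_le not_le)
      then have "norm (T s) \<le> norm (T d) * norm (T (s - d))"
        using norm_blinfun_compose by simp
      also have "\<dots> \<le> K * L"
      proof (rule mult_mono)
        show "norm (T d) \<le> K" using K d by simp
        then show "0 \<le> K" using norm_ge_zero order_trans by blast
        show "norm (T (s - d)) \<le> L" using s False by (intro L) (auto simp: algebra_simps)
      qed simp
      finally show ?thesis by simp
    qed
    then show ?case by blast
  qed
  moreover obtain n where "t < real n * d"
    using d reals_Archimedean3 by blast
  ultimately show ?thesis
    by (meson atLeastAtMost_iff less_imp_le order_trans)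
qed

section \<open>The maximal output\<close>

lemma output_le_max_output:
  fixes C :: "'a::banach \<Rightarrow>\<^sub>L 'b::banach"
  assumes T: "C0_semigroup T" and s: "0 \<le> s" "s \<le> t"
  shows "norm (C (T s x)) \<le> max_output T C t x"
proof -
  obtain K where K: "\<And>s. s \<in> {0..t} \<Longrightarrow> norm (T s) \<le> K"
    using C0_semigroup_bounded_on_compact[OF T] by blast
  have "norm (C (T s x)) \<le> norm C * (K * norm x)" if "s \<in> {0..t}" for s
    by (meson K that mult_left_mono mult_right_mono norm_blinfun norm_ge_zero order_trans)
  then have "bdd_above ((\<lambda>s. norm (C (T s x))) ` {0..t})"
    by (intro bdd_aboveI2)
  then show ?thesis
    unfolding max_output_def output_trajectory_def mild_solution_def
    using s by (intro cSUP_upper) auto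
qed

lemma max_output_le:
  fixes T :: "real \<Rightarrow> 'a::banach \<Rightarrow>\<^sub>L 'a" and C :: "'a \<Rightarrow>\<^sub>L 'b::banach"
  assumes "0 \<le> t" "\<And>s. 0 \<le> s \<Longrightarrow> s \<le> t \<Longrightarrow> norm (C (T s x)) \<le> B"
  shows "max_output T C t x \<le> B"
  unfolding max_output_def output_trajectory_def mild_solution_def
  using assms by (intro cSUP_least) auto

lemma max_output_nonneg:
  assumes "C0_semigroup T" "0 \<le> t"
  shows "0 \<le> max_output T C t x"
  using output_le_max_output[OF assms(1) order_refl assms(2)] norm_ge_zero order_trans by blast

lemma max_output_mono:
  assumes "C0_semigroup T" "0 \<le> s" "s \<le> t"
  shows "max_output T C s x \<le> max_output T C t x"
  using assms by (intro max_output_le output_le_max_output) auto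

lemma max_output_shift:
  assumes T: "C0_semigroup T" and "0 \<le> s" "0 \<le> t"
  shows "max_output T C t (T s x) \<le> max_output T C (s + t) x"
proof (rule max_output_le)
  fix r assume "0 \<le> r" "r \<le> t"
  then show "norm (C (T r (T s x))) \<le> max_output T C (s + t) x"
    using output_le_max_output[OF T, of "r + s" "s + t"] C0_semigroup_add[OF T, of r s] assms
    by simp
qed fact

lemma max_output_scaleR:
  assumes T: "C0_semigroup T" and "0 \<le> c" "0 \<le> t"
  shows "max_output T C t (c *\<^sub>R x) \<le> c * max_output T C t x"
  using assms output_le_max_output[OF T]
  by (intro max_output_le) (auto simp: blinfun.scaleR_right intro!: mult_left_mono)

section \<open>From OSS to exponential OSS with linear gain\<close>

lemma class_K_mono: "\<gamma> \<in> class_K \<Longrightarrow> 0 \<le> a \<Longrightarrow> a \<le> b \<Longrightarrow> \<gamma> a \<le> \<gamma> b"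
  unfolding class_K_def by (auto simp: strict_mono_on_def order_le_less)

lemma class_K_pos:
  assumes "\<gamma> \<in> class_K" "a > 0"
  shows "\<gamma> a > 0"
proof -
  have "strict_mono_on {0..} \<gamma>" "\<gamma> 0 = 0"
    using assms by (auto simp: class_K_def)
  then show ?thesis
    using assms(2) strict_mono_onD[of "{0..}" \<gamma> 0 a] by simp
qed

lemma class_K_small:
  assumes "\<gamma> \<in> class_K" "\<epsilon> > 0"
  shows "\<exists>\<delta>>0. \<gamma> \<delta> < \<epsilon>"
proof -
  have "continuous_on {0..} \<gamma>" "\<gamma> 0 = 0" using assms by (auto simp: class_K_def)
  then obtain d where d: "d > 0" "\<And>x. x \<ge> 0 \<Longrightarrow> dist x 0 < d \<Longrightarrow> dist (\<gamma> x) 0 < \<epsilon>"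
    using assms(2) unfolding continuous_on_iff by (metis atLeast_iff order_refl)
  then have "dist (\<gamma> (d / 2)) 0 < \<epsilon>" by simp
  with d(1) show ?thesis by (intro exI[of _ "d / 2"]) (auto simp: dist_real_def)
qed

lemma class_L_mono: "\<beta> \<in> class_L \<Longrightarrow> 0 \<le> a \<Longrightarrow> a \<le> b \<Longrightarrow> \<beta> b \<le> \<beta> a"
  unfolding class_L_def by (auto simp: monotone_on_def order_le_less)

lemma class_L_small:
  assumes "\<beta> \<in> class_L" "\<epsilon> > 0"
  shows "\<exists>t>0. \<beta> t < \<epsilon>"
proof -
  have "(\<beta> \<longlongrightarrow> 0) at_top" using assms by (simp add: class_L_def)
  then have "\<forall>\<^sub>F t in at_top. \<beta> t < \<epsilon>" using assms(2) by (rule order_tendstoD)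
  then have "\<forall>\<^sub>F t in at_top. \<beta> t < \<epsilon> \<and> 0 < t"
    using eventually_gt_at_top by (rule eventually_conj)
  then show ?thesis unfolding eventually_at_top_linorder by blast
qed

text \<open>
  The scaling factor is the reciprocal of \<open>\<parallel>x\<parallel> + m_t(x) / \<delta>\<close>. It brings the norm of the state below
  \<open>1\<close> and the maximal output below \<open>\<delta>\<close> at once, so that the nonlinear functions are evaluated only
  at these two points.
\<close>

lemma OSS_estimate_homogenized:
  assumes T: "C0_semigroup T" and \<beta>: "\<beta> \<in> class_KL" and \<gamma>: "\<gamma> \<in> class_K"
    and est: "OSS_estimate T C \<beta> \<gamma>" and \<delta>: "\<delta> > 0" and t: "t \<ge> 0"
  shows "norm (T t x) \<le> (\<beta> 1 t + \<gamma> \<delta>) * (norm x + max_output T C t x / \<delta>)"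
proof (cases "x = 0")
  case True
  have "\<beta> 1 t > 0" "\<gamma> \<delta> > 0"
    using \<beta> t class_K_pos[OF \<gamma> \<delta>] class_K_pos[of "\<lambda>r. \<beta> r t" 1]
    by (auto simp: class_KL_def)
  then show ?thesis
    using True max_output_nonneg[OF T t, of C 0] \<delta> by simp
next
  case False
  define m where "m = max_output T C t x"
  define R where "R = norm x + m / \<delta>"
  define l where "l = 1 / R"
  have m: "m \<ge> 0" unfolding m_def using T t by (rule max_output_nonneg)
  have R: "R > 0" using False m \<delta> by (simp add: R_def add_pos_nonneg)
  have l: "l > 0" using R by (simp add: l_def)
  have lx: "norm (l *\<^sub>R x) \<le> 1"
    using R m \<delta> by (simp add: l_def R_def)
  have "l * m \<le> \<delta>"
    using R \<delta> m by (simp add: l_def R_def field_simps)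
  then have lm: "max_output T C t (l *\<^sub>R x) \<le> \<delta>"
    using max_output_scaleR[OF T less_imp_le[OF l] t, of C x] by (simp add: m_def)
  have "l * norm (T t x) = norm (T t (l *\<^sub>R x))"
    using l by (simp add: blinfun.scaleR_right)
  also have "\<dots> \<le> \<beta> (norm (l *\<^sub>R x)) t + \<gamma> (max_output T C t (l *\<^sub>R x))"
    using est t unfolding OSS_estimate_def mild_solution_def by blast
  also have "\<dots> \<le> \<beta> 1 t + \<gamma> \<delta>"
  proof (rule add_mono)
    show "\<beta> (norm (l *\<^sub>R x)) t \<le> \<beta> 1 t"
      using class_K_mono[of "\<lambda>r. \<beta> r t" "norm (l *\<^sub>R x)" 1] \<beta> t lx by (auto simp: class_KL_def)
    show "\<gamma> (max_output T C t (l *\<^sub>R x)) \<le> \<gamma> \<delta>"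
      using \<gamma> max_output_nonneg[OF T t] lm by (rule class_K_mono)
  qed
  finally have "norm (T t x) \<le> (\<beta> 1 t + \<gamma> \<delta>) * R"
    using R by (simp add: l_def field_simps)
  then show ?thesis by (simp add: R_def m_def)
qed

text \<open>
  The output contributions of successive intervals are damped by successive powers of \<open>1/2\<close>, so
  that their sum is at most twice a single one.
\<close>

lemma halving_iterated:
  assumes T: "C0_semigroup T" and \<tau>: "\<tau> \<ge> 0" and a: "a \<ge> 0"
    and halve: "\<And>x. norm (T \<tau> x) \<le> norm x / 2 + a * max_output T C \<tau> x"
  shows "norm (T (real n * \<tau>) x)
           \<le> (1 / 2) ^ n * norm x + 2 * a * max_output T C (real n * \<tau>) x"
proof (induction n)
  case 0
  then show ?case
    using C0_semigroup_zero[OF T, of x] max_output_nonneg[OF T order_refl, of C x] a by simp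
next
  case (Suc n)
  define M where "M = max_output T C (real (Suc n) * \<tau>) x"
  have eq: "real (Suc n) * \<tau> = \<tau> + real n * \<tau>" by (simp add: algebra_simps)
  have "norm (T (real (Suc n) * \<tau>) x) = norm (T \<tau> (T (real n * \<tau>) x))"
    using \<tau> by (simp only: eq C0_semigroup_add[OF T] mult_nonneg_nonneg of_nat_0_le_iff)
  also have "\<dots> \<le> norm (T (real n * \<tau>) x) / 2 + a * max_output T C \<tau> (T (real n * \<tau>) x)"
    by (rule halve)
  also have "\<dots> \<le> ((1 / 2) ^ n * norm x + 2 * a * M) / 2 + a * M"
  proof -
    have "max_output T C (real n * \<tau>) x \<le> M"
      unfolding M_def eq using \<tau> by (intro max_output_mono[OF T]) auto
    then have "norm (T (real n * \<tau>) x) \<le> (1 / 2) ^ n * norm x + 2 * a * M"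
      using Suc.IH a mult_left_mono[of "max_output T C (real n * \<tau>) x" M "2 * a"] by linarith
    moreover have "max_output T C \<tau> (T (real n * \<tau>) x) \<le> M"
      using max_output_shift[OF T, of "real n * \<tau>" \<tau> C x] \<tau>
      unfolding M_def eq by (simp add: add.commute)
    ultimately show ?thesis using a by (intro add_mono divide_right_mono mult_left_mono) auto
  qed
  also have "\<dots> = (1 / 2) ^ Suc n * norm x + 2 * a * M"
    by (simp add: field_simps)
  finally show ?case by (simp add: M_def)
qed

text \<open>The factor \<open>2\<close> makes up for the incomplete last period of length \<open>\<tau>\<close>.\<close>

lemma half_power_floor_le_exp:
  fixes t \<tau> :: real
  assumes "\<tau> > 0" "t \<ge> 0"
  shows "(1 / 2) ^ nat \<lfloor>t / \<tau>\<rfloor> \<le> 2 * exp (- (ln 2 / \<tau>) * t)"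
proof -
  define n where "n = nat \<lfloor>t / \<tau>\<rfloor>"
  have "t / \<tau> \<le> real n + 1"
    using assms unfolding n_def by simp
  then have "t / \<tau> * ln 2 \<le> (real n + 1) * ln (2::real)"
    by (intro mult_right_mono) auto
  then have "ln 2 - (ln 2 / \<tau>) * t \<ge> - (real n * ln 2)"
    by (simp add: algebra_simps)
  then have "exp (- (real n * ln 2)) \<le> exp (ln 2 - (ln 2 / \<tau>) * t)"
    by simp
  moreover have "exp (- (real n * ln 2)) = (1 / 2) ^ n"
    by (simp add: exp_minus exp_of_nat_mult power_one_over inverse_eq_divide)
  moreover have "exp (ln 2 - (ln 2 / \<tau>) * t) = 2 * exp (- (ln 2 / \<tau>) * t)"
    by (simp add: exp_diff exp_minus divide_inverse)
  ultimately show ?thesis unfolding n_def by linarith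
qed

lemma linear_in_class_K: "c > 0 \<Longrightarrow> (\<lambda>r. c * r) \<in> class_K"
  unfolding class_K_def
  by (auto intro!: continuous_intros strict_mono_onI mult_strict_left_mono)

lemma OSS_imp_eOSS_linear_gain:
  assumes T: "C0_semigroup T" and "OSS T C"
  shows "eOSS_linear_gain T C"
proof -
  obtain \<beta> \<gamma> where \<beta>: "\<beta> \<in> class_KL" and \<gamma>: "\<gamma> \<in> class_K" and est: "OSS_estimate T C \<beta> \<gamma>"
    using assms(2) unfolding OSS_def by blast
  have \<beta>1: "\<beta> 1 \<in> class_L" using \<beta> by (simp add: class_KL_def)
  obtain \<delta> where \<delta>: "\<delta> > 0" "\<gamma> \<delta> < 1 / 4"
    using class_K_small[OF \<gamma>, of "1 / 4"] by auto
  obtain \<tau> where \<tau>: "\<tau> > 0" "\<beta> 1 \<tau> < 1 / 4"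
    using class_L_small[OF \<beta>1, of "1 / 4"] by auto
  note hom = OSS_estimate_homogenized[OF T \<beta> \<gamma> est \<delta>(1)]
  define B where "B = \<beta> 1 0 + \<gamma> \<delta>"
  have B: "B > 0"
  proof -
    have "\<beta> 1 0 \<ge> 0" using \<beta>1 by (auto simp: class_L_def)
    then show ?thesis using class_K_pos[OF \<gamma> \<delta>(1)] by (simp add: B_def)
  qed
  have halve: "norm (T \<tau> x) \<le> norm x / 2 + 1 / (2 * \<delta>) * max_output T C \<tau> x" for x
  proof -
    have "norm (T \<tau> x) \<le> (\<beta> 1 \<tau> + \<gamma> \<delta>) * (norm x + max_output T C \<tau> x / \<delta>)"
      using hom \<tau> by simp
    also have "\<dots> \<le> 1 / 2 * (norm x + max_output T C \<tau> x / \<delta>)"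
      using \<tau> \<delta> max_output_nonneg[OF T, of \<tau> C x] by (intro mult_right_mono) auto
    finally show ?thesis by (simp add: field_simps)
  qed
  have "norm (T t x) \<le> 2 * B * exp (- (ln 2 / \<tau>) * t) * norm x
          + 2 * B / \<delta> * max_output T C t x" if t: "t \<ge> 0" for t x
  proof -
    define n where "n = nat \<lfloor>t / \<tau>\<rfloor>"
    define s where "s = t - real n * \<tau>"
    define M where "M = max_output T C t x"
    define z where "z = T (real n * \<tau>) x"
    have "real n \<le> t / \<tau>" using t \<tau> by (simp add: n_def)
    then have s: "s \<ge> 0" using \<tau> by (simp add: s_def field_simps)
    have nt: "0 \<le> real n * \<tau>" "real n * \<tau> \<le> t" using \<tau> s by (auto simp: s_def)
    have ts: "t = s + real n * \<tau>" by (simp add: s_def)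
    have "norm z \<le> (1 / 2) ^ n * norm x + 1 / \<delta> * max_output T C (real n * \<tau>) x"
      using halving_iterated[OF T _ _ halve, of n x] \<tau> \<delta> by (simp add: z_def)
    also have "\<dots> \<le> 2 * exp (- (ln 2 / \<tau>) * t) * norm x + 1 / \<delta> * M"
      using half_power_floor_le_exp[OF \<tau>(1) t] max_output_mono[OF T nt] \<delta>
      unfolding n_def[symmetric] M_def by (intro add_mono mult_right_mono mult_left_mono) auto
    finally have z: "norm z \<le> 2 * exp (- (ln 2 / \<tau>) * t) * norm x + 1 / \<delta> * M" .
    have Mz: "max_output T C s z \<le> M"
      using max_output_shift[OF T nt(1) s, of C x] by (simp add: z_def M_def s_def)
    have "norm (T t x) = norm (T s z)"
      unfolding z_def by (subst ts) (simp add: C0_semigroup_add[OF T s nt(1)])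
    also have "\<dots> \<le> (\<beta> 1 s + \<gamma> \<delta>) * (norm z + max_output T C s z / \<delta>)"
      using hom[OF s] .
    also have "\<dots> \<le> B * (norm z + max_output T C s z / \<delta>)"
      using class_L_mono[OF \<beta>1 order_refl s] max_output_nonneg[OF T s, of C z] \<delta>
      unfolding B_def by (intro mult_right_mono) auto
    also have "\<dots> \<le> B * ((2 * exp (- (ln 2 / \<tau>) * t) * norm x + 1 / \<delta> * M) + M / \<delta>)"
      using z Mz B \<delta> by (intro mult_left_mono add_mono divide_right_mono) auto
    also have "\<dots> = 2 * B * exp (- (ln 2 / \<tau>) * t) * norm x + 2 * B / \<delta> * M"
      by (simp add: algebra_simps)
    finally show ?thesis by (simp add: M_def)
  qed
  then have "eOSS_estimate T C (2 * B) (ln 2 / \<tau>) (\<lambda>r. 2 * B / \<delta> * r)"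
    by (simp add: eOSS_estimate_def mild_solution_def)
  moreover have "(\<lambda>r. 2 * B / \<delta> * r) \<in> class_K"
    using B \<delta> by (intro linear_in_class_K) simp
  moreover have "linear_gain (\<lambda>r. 2 * B / \<delta> * r)"
    unfolding linear_gain_def by blast
  moreover have "2 * B > 0" "ln 2 / \<tau> > 0"
    using B \<tau> by auto
  ultimately show ?thesis unfolding eOSS_linear_gain_def by blast
qed

section \<open>Exponential bounds as comparison functions\<close>

lemma exp_decay_in_class_KL:
  assumes "M > 0" "\<mu> > 0"
  shows "(\<lambda>r t. M * exp (- \<mu> * t) * r) \<in> class_KL"
proof -
  have "(\<lambda>t. M * exp (- \<mu> * t) * r) \<in> class_L" if r: "r > 0" for r
  proof -
    have "((\<lambda>t. exp (- \<mu> * t)) \<longlongrightarrow> 0) at_top"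
    proof (rule filterlim_compose[OF exp_at_bot])
      show "filterlim (\<lambda>t. - \<mu> * t) at_bot at_top"
        using assms by (intro filterlim_tendsto_neg_mult_at_bot[OF tendsto_const]) (auto simp: filterlim_ident)
    qed
    then have "((\<lambda>t. M * exp (- \<mu> * t) * r) \<longlongrightarrow> M * 0 * r) at_top"
      by (intro tendsto_intros)
    moreover have "strict_antimono_on {0..} (\<lambda>t. M * exp (- \<mu> * t) * r)"
      using assms r by (auto simp: monotone_on_def)
    ultimately show ?thesis
      using assms r by (auto simp: class_L_def intro!: continuous_intros)
  qed
  moreover have "(\<lambda>r. M * exp (- \<mu> * t) * r) \<in> class_K" for t
    using assms by (intro linear_in_class_K) simp
  moreover have "continuous_on ({0..} \<times> {0..}) (\<lambda>(r, t). M * exp (- \<mu> * t) * r)"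
    unfolding case_prod_beta by (intro continuous_intros)
  ultimately show ?thesis unfolding class_KL_def by simp
qed

lemma OSS_estimate_of_eOSS_estimate:
  "eOSS_estimate T C M \<mu> \<gamma> \<Longrightarrow> OSS_estimate T C (\<lambda>r t. M * exp (- \<mu> * t) * r) \<gamma>"
  by (simp add: eOSS_estimate_def OSS_estimate_def)

theorem proposition2p3:
  fixes D :: "'a::banach set"
    and A :: "'a \<Rightarrow> 'a"
    and T :: "real \<Rightarrow> 'a \<Rightarrow>\<^sub>L 'a"
    and C :: "'a \<Rightarrow>\<^sub>L 'b::banach"
  assumes "generates_C0_semigroup D A T"
  shows "(OSS T C \<longleftrightarrow> OSS_linear_gain T C) \<and>
         (OSS_linear_gain T C \<longleftrightarrow> eOSS T C) \<and>
         (eOSS T C \<longleftrightarrow> eOSS_linear_gain T C)"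
proof -
  have "C0_semigroup T" using assms by (simp add: generates_C0_semigroup_def)
  then have 1: "OSS T C \<Longrightarrow> eOSS_linear_gain T C"
    by (rule OSS_imp_eOSS_linear_gain)
  have 2: "eOSS_linear_gain T C \<Longrightarrow> OSS_linear_gain T C"
    unfolding eOSS_linear_gain_def OSS_linear_gain_def
    using exp_decay_in_class_KL OSS_estimate_of_eOSS_estimate by metis
  have 3: "eOSS T C \<Longrightarrow> OSS T C"
    unfolding eOSS_def OSS_def
    using exp_decay_in_class_KL OSS_estimate_of_eOSS_estimate by metis
  have 4: "OSS_linear_gain T C \<Longrightarrow> OSS T C"
    unfolding OSS_linear_gain_def OSS_def by blast
  have 5: "eOSS_linear_gain T C \<Longrightarrow> eOSS T C"
    unfolding eOSS_linear_gain_def eOSS_def by blast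
  show ?thesis using 1 2 3 4 5 by blast
qed

end
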